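(* Let $I\subset\mathbb{R}$ be an open interval and let $\alpha: I\to E^3$ be a curve parametrized by arc length $s$, with Bishop frame $\{T,M_1,M_2\}$ and corresponding curvature functions $k_1,k_2$, each nowhere zero on $I$. Then $\alpha$ is a generalized helix if and only if $$k_1(s)\int k_1(s)\,ds+k_2(s)\int k_2(s)\,ds=0 ,$$ that is, if and only if there exist antiderivatives $K_1,K_2: I\to\mathbb{R}$ of $k_1,k_2$ (i.e. $K_i'=k_i$) such that $k_1(s)K_1(s)+k_2(s)K_2(s)=0$ for all $s\in I$.
   Context: $E^3$ is $\mathbb{R}^3$ with the standard inner product $\langle\cdot,\cdot\rangle$. All curves, frames and functions are assumed smooth. Bishop frame: for a unit speed curve $\alpha: I\to E^3$ with $T=\alpha'$, a Bishop frame is an orthonormal frame field $\{T,M_1,M_2\}$ along $\alpha$ such that $$T'=k_1M_1+k_2M_2,\qquad M_i'=-k_iT\quad(i=1,2),$$ where $k_i=\langle T',M_i\rangle$ are the curvature functions of $\alpha$ according to this frame. Generalized helix: a unit speed curve $\alpha: I\to E^3$ is a generalized helix if there is a fixed unit vector $X\in E^3$ and a constant angle $\theta\neq\frac{\pi}{2}$ with $\langle\alpha'(s),X\rangle=\cos\theta$ for all $s\in I$. *)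

theory Defs
  imports "HOL-Analysis.Analysis"
begin

text \<open>Curves, frame fields and functions are total functions on \<^typ>\<open>real\<close>, considered only on an
  open set \<open>I\<close>. Since \<open>I\<close> is open, all derivatives at points of \<open>I\<close> depend only on
  the values on \<open>I\<close>.\<close>

definition smooth_on :: "real set \<Rightarrow> (real \<Rightarrow> 'a::real_normed_vector) \<Rightarrow> bool" where
  "smooth_on I f \<longleftrightarrow>
     (\<forall>n. \<forall>s\<in>I. ((\<lambda>g t. vector_derivative g (at t)) ^^ n) f differentiable (at s))"

definition tangent :: "(real \<Rightarrow> real^3) \<Rightarrow> real \<Rightarrow> real^3" where
  "tangent \<alpha> s = vector_derivative \<alpha> (at s)"

definition unit_speed_curve :: "real set \<Rightarrow> (real \<Rightarrow> real^3) \<Rightarrow> bool" where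
  "unit_speed_curve I \<alpha> \<longleftrightarrow> smooth_on I \<alpha> \<and> (\<forall>s\<in>I. norm (tangent \<alpha> s) = 1)"

definition orthonormal_frame_field ::
    "real set \<Rightarrow> (real \<Rightarrow> real^3) \<Rightarrow> (real \<Rightarrow> real^3) \<Rightarrow> (real \<Rightarrow> real^3) \<Rightarrow> bool" where
  "orthonormal_frame_field I E1 E2 E3 \<longleftrightarrow>
     smooth_on I E1 \<and> smooth_on I E2 \<and> smooth_on I E3 \<and>
     (\<forall>s\<in>I. norm (E1 s) = 1 \<and> norm (E2 s) = 1 \<and> norm (E3 s) = 1 \<and>
            E1 s \<bullet> E2 s = 0 \<and> E1 s \<bullet> E3 s = 0 \<and> E2 s \<bullet> E3 s = 0)"

text \<open>The curvature functions are \<open>k\<^sub>i = \<langle>T', M\<^sub>i\<rangle>\<close>.\<close>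

definition bishop_curvature :: "(real \<Rightarrow> real^3) \<Rightarrow> (real \<Rightarrow> real^3) \<Rightarrow> real \<Rightarrow> real" where
  "bishop_curvature \<alpha> M s = vector_derivative (tangent \<alpha>) (at s) \<bullet> M s"

definition bishop_frame ::
    "real set \<Rightarrow> (real \<Rightarrow> real^3) \<Rightarrow> (real \<Rightarrow> real^3) \<Rightarrow> (real \<Rightarrow> real^3) \<Rightarrow> bool" where
  "bishop_frame I \<alpha> M1 M2 \<longleftrightarrow>
     orthonormal_frame_field I (tangent \<alpha>) M1 M2 \<and>
     (\<forall>s\<in>I.
        (tangent \<alpha> has_vector_derivative
           bishop_curvature \<alpha> M1 s *\<^sub>R M1 s + bishop_curvature \<alpha> M2 s *\<^sub>R M2 s) (at s) \<and>
        (M1 has_vector_derivative - (bishop_curvature \<alpha> M1 s *\<^sub>R tangent \<alpha> s)) (at s) \<and>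
        (M2 has_vector_derivative - (bishop_curvature \<alpha> M2 s *\<^sub>R tangent \<alpha> s)) (at s))"

text \<open>As the angle between two unit vectors, \<open>\<theta>\<close> ranges over \<open>[0, \<pi>]\<close>. Without this
  restriction \<open>\<theta> = 3\<pi>/2\<close> would bring back the excluded case \<open>cos \<theta> = 0\<close>.\<close>

definition generalized_helix :: "real set \<Rightarrow> (real \<Rightarrow> real^3) \<Rightarrow> bool" where
  "generalized_helix I \<alpha> \<longleftrightarrow> unit_speed_curve I \<alpha> \<and>
     (\<exists>X \<theta>. norm X = 1 \<and> 0 \<le> \<theta> \<and> \<theta> \<le> pi \<and> \<theta> \<noteq> pi / 2 \<and>
            (\<forall>s\<in>I. tangent \<alpha> s \<bullet> X = cos \<theta>))"

end

theory Submission
  imports Defs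
begin

text \<open>If \<open>X\<close> is the axis and \<open>c = \<langle>T, X\<rangle> \<noteq> 0\<close>, the functions \<open>K\<^sub>i = - \<langle>M\<^sub>i, X\<rangle> / c\<close> are the
  required antiderivatives, because \<open>\<langle>T', X\<rangle> = 0\<close>. Conversely, \<open>T - K\<^sub>1 M\<^sub>1 - K\<^sub>2 M\<^sub>2\<close> has
  derivative \<open>(k\<^sub>1 K\<^sub>1 + k\<^sub>2 K\<^sub>2) T = 0\<close>, so it is a constant vector; its inner product
  with \<open>T\<close> is 1, and normalizing it gives the axis.\<close>

theorem corollary3:
  fixes I :: "real set"
    and \<alpha> M1 M2 :: "real \<Rightarrow> real^3"
    and k1 k2 :: "real \<Rightarrow> real"
  assumes "open I" and "is_interval I" and "I \<noteq> {}"
    and "unit_speed_curve I \<alpha>"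
    and "bishop_frame I \<alpha> M1 M2"
    and "\<And>s. s \<in> I \<Longrightarrow> k1 s = bishop_curvature \<alpha> M1 s"
    and "\<And>s. s \<in> I \<Longrightarrow> k2 s = bishop_curvature \<alpha> M2 s"
    and "\<And>s. s \<in> I \<Longrightarrow> k1 s \<noteq> 0"
    and "\<And>s. s \<in> I \<Longrightarrow> k2 s \<noteq> 0"
  shows "generalized_helix I \<alpha> \<longleftrightarrow>
    (\<exists>K1 K2 :: real \<Rightarrow> real.
       (\<forall>s\<in>I. (K1 has_real_derivative k1 s) (at s)) \<and>
       (\<forall>s\<in>I. (K2 has_real_derivative k2 s) (at s)) \<and>
       (\<forall>s\<in>I. k1 s * K1 s + k2 s * K2 s = 0))"
proof
  \<comment> \<open>The Bishop equations, written with \<open>k1\<close> and \<open>k2\<close>,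
    serve both directions.\<close>
  have T': "(tangent \<alpha> has_vector_derivative k1 s *\<^sub>R M1 s + k2 s *\<^sub>R M2 s) (at s)"
    and M1': "(M1 has_vector_derivative - (k1 s *\<^sub>R tangent \<alpha> s)) (at s)"
    and M2': "(M2 has_vector_derivative - (k2 s *\<^sub>R tangent \<alpha> s)) (at s)"
    and orth: "tangent \<alpha> s \<bullet> tangent \<alpha> s = 1" "tangent \<alpha> s \<bullet> M1 s = 0" "tangent \<alpha> s \<bullet> M2 s = 0"
    if "s \<in> I" for s
    using assms(5-7) that
    by (auto simp: bishop_frame_def orthonormal_frame_field_def dot_square_norm)
  {
    assume "generalized_helix I \<alpha>"
    then obtain X \<theta> where \<theta>: "0 \<le> \<theta>" "\<theta> \<le> pi" "\<theta> \<noteq> pi / 2"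
      and X: "\<And>s. s \<in> I \<Longrightarrow> tangent \<alpha> s \<bullet> X = cos \<theta>"
      unfolding generalized_helix_def by blast
    \<comment> \<open>Cosine is injective on [0, pi], so \<open>pi / 2\<close> is its only zero
      there; this is where the range of \<theta> enters.\<close>
    have c: "cos \<theta> \<noteq> 0"
      using cos_inj_pi[of \<theta> "pi / 2"] \<theta> by auto
    define K where "K M s = - (M s \<bullet> X) / cos \<theta>" for M :: "real \<Rightarrow> real^3" and s
    \<comment> \<open>Kept general in \<open>M\<close> and \<open>k\<close> to cover
      \<open>M1\<close> and \<open>M2\<close> at once. Since T has constant component cos \<theta>
      along X, that of \<open>M\<close> has derivative -k cos \<theta>, and dividing by -cos
      \<theta> leaves k.\<close>
    have deriv_K: "(K M has_real_derivative k) (at s)"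
      if "s \<in> I" "(M has_vector_derivative - (k *\<^sub>R tangent \<alpha> s)) (at s)" for M k s
    proof -
      have "((\<lambda>t. M t \<bullet> X) has_vector_derivative - (k *\<^sub>R tangent \<alpha> s) \<bullet> X) (at s)"
        using bounded_linear.has_vector_derivative[OF bounded_linear_inner_left that(2)] .
      then have "((\<lambda>t. M t \<bullet> X) has_real_derivative - (k * cos \<theta>)) (at s)"
        using X[OF that(1)] by (simp add: has_real_derivative_iff_has_vector_derivative)
      then have "((\<lambda>t. - (M t \<bullet> X) / cos \<theta>) has_real_derivative - (- (k * cos \<theta>)) / cos \<theta>) (at s)"
        by (intro DERIV_cdivide DERIV_minus)
      then show ?thesis
        using c by (simp add: K_def[abs_def])
    qed
    have "k1 s * K M1 s + k2 s * K M2 s = 0" if s: "s \<in> I" for s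
    proof -
      \<comment> \<open>The component of T along X is differentiated in two ways: by the Bishop
        equation, and as a function constant on the open set \<open>I\<close>. Equating the results
        shows that X is orthogonal to T'.\<close>
      have "((\<lambda>t. tangent \<alpha> t \<bullet> X) has_vector_derivative
          (k1 s *\<^sub>R M1 s + k2 s *\<^sub>R M2 s) \<bullet> X) (at s)"
        using bounded_linear.has_vector_derivative[OF bounded_linear_inner_left T'[OF s]] .
      moreover have "((\<lambda>t. tangent \<alpha> t \<bullet> X) has_vector_derivative 0) (at s)"
        using has_vector_derivative_transform_within_open
          [OF has_vector_derivative_const \<open>open I\<close> s, of "cos \<theta>" "\<lambda>t. tangent \<alpha> t \<bullet> X"] X
        by simp
      ultimately have "(k1 s *\<^sub>R M1 s + k2 s *\<^sub>R M2 s) \<bullet> X = 0"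
        by (rule vector_derivative_unique_at)
      then show ?thesis
        using c by (simp add: K_def inner_add_left field_simps)
    qed
    then show "\<exists>K1 K2 :: real \<Rightarrow> real.
       (\<forall>s\<in>I. (K1 has_real_derivative k1 s) (at s)) \<and>
       (\<forall>s\<in>I. (K2 has_real_derivative k2 s) (at s)) \<and>
       (\<forall>s\<in>I. k1 s * K1 s + k2 s * K2 s = 0)"
      using deriv_K M1' M2' by blast
  next
    assume "\<exists>K1 K2 :: real \<Rightarrow> real.
       (\<forall>s\<in>I. (K1 has_real_derivative k1 s) (at s)) \<and>
       (\<forall>s\<in>I. (K2 has_real_derivative k2 s) (at s)) \<and>
       (\<forall>s\<in>I. k1 s * K1 s + k2 s * K2 s = 0)"
    then obtain K1 K2 :: "real \<Rightarrow> real"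
      where K1': "\<And>s. s \<in> I \<Longrightarrow> (K1 has_real_derivative k1 s) (at s)"
        and K2': "\<And>s. s \<in> I \<Longrightarrow> (K2 has_real_derivative k2 s) (at s)"
        and K: "\<And>s. s \<in> I \<Longrightarrow> k1 s * K1 s + k2 s * K2 s = 0"
      by blast
    \<comment> \<open>In the first direction, expanding X in the frame gives X = cos \<theta> (T -
      K1 M1 - K2 M2), so \<open>V\<close> is the natural candidate for a multiple of the
      axis.\<close>
    define V where "V s = tangent \<alpha> s - K1 s *\<^sub>R M1 s - K2 s *\<^sub>R M2 s" for s
    have "(V has_vector_derivative 0) (at s)" if s: "s \<in> I" for s
    proof -
      \<comment> \<open>By the product rule the terms in \<open>M1\<close> and \<open>M2\<close>
        cancel, and only a multiple of T survives.\<close>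
      have "(V has_vector_derivative
          (k1 s *\<^sub>R M1 s + k2 s *\<^sub>R M2 s)
          - (K1 s *\<^sub>R (- (k1 s *\<^sub>R tangent \<alpha> s)) + k1 s *\<^sub>R M1 s)
          - (K2 s *\<^sub>R (- (k2 s *\<^sub>R tangent \<alpha> s)) + k2 s *\<^sub>R M2 s)) (at s)"
        unfolding V_def[abs_def]
        by (intro has_vector_derivative_diff has_vector_derivative_scaleR T' M1' M2' K1' K2' s)
      also have "(k1 s *\<^sub>R M1 s + k2 s *\<^sub>R M2 s)
          - (K1 s *\<^sub>R (- (k1 s *\<^sub>R tangent \<alpha> s)) + k1 s *\<^sub>R M1 s)
          - (K2 s *\<^sub>R (- (k2 s *\<^sub>R tangent \<alpha> s)) + k2 s *\<^sub>R M2 s)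
          = (k1 s * K1 s + k2 s * K2 s) *\<^sub>R tangent \<alpha> s"
        by (simp add: algebra_simps)
      finally show ?thesis
        using K[OF s] by simp
    qed
    \<comment> \<open>An interval is convex, so a vanishing derivative forces a single constant
      value on all of \<open>I\<close>.\<close>
    then have "\<exists>v. \<forall>s\<in>I. V s = v"
      using has_vector_derivative_zero_constant[of I V] \<open>is_interval I\<close>
      by (metis has_vector_derivative_at_within is_interval_convex)
    then obtain v where v: "\<And>s. s \<in> I \<Longrightarrow> V s = v"
      by blast
    have Tv: "tangent \<alpha> s \<bullet> v = 1" if "s \<in> I" for s
      using orth[OF that] v[OF that] by (auto simp: V_def inner_diff_right)
    \<comment> \<open>Cauchy-Schwarz at one point of the nonempty \<open>I\<close>. The bound makes
      \<open>v\<close> nonzero and puts \<open>1 / norm v\<close> in the domain of arccos.\<close>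
    have norm_v: "norm v \<ge> 1"
    proof -
      obtain s where s: "s \<in> I"
        using \<open>I \<noteq> {}\<close> by blast
      then have "norm (tangent \<alpha> s) = 1"
        using orth(1) by (simp add: norm_eq_1)
      then show ?thesis
        using norm_cauchy_schwarz[of "tangent \<alpha> s" v] Tv[OF s] by simp
    qed
    then have "v \<noteq> 0"
      by auto
    \<comment> \<open>The component of T along the normalized \<open>v\<close> is
      \<open>1 / norm v\<close>, by \<open>Tv\<close>. It is nonzero, which rules out the angle
      \<open>pi / 2\<close>.\<close>
    define \<theta> where "\<theta> = arccos (1 / norm v)"
    have "- 1 \<le> 1 / norm v"
      by (rule order_trans[of _ 0]) simp_all
    moreover have "1 / norm v \<le> 1"
      by (rule divide_le_eq_1_pos[THEN iffD2]) (use norm_v in linarith)+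
    ultimately have \<theta>: "cos \<theta> = 1 / norm v" "0 \<le> \<theta>" "\<theta> \<le> pi"
      unfolding \<theta>_def by (rule cos_arccos arccos_lbound arccos_ubound; assumption)+
    moreover have "\<theta> \<noteq> pi / 2"
      using \<theta>(1) \<open>v \<noteq> 0\<close> cos_pi_half by force
    moreover have "norm (v /\<^sub>R norm v) = 1"
      using \<open>v \<noteq> 0\<close> by simp
    moreover have "\<forall>s\<in>I. tangent \<alpha> s \<bullet> (v /\<^sub>R norm v) = cos \<theta>"
      using Tv \<theta>(1) by (simp add: divide_inverse)
    ultimately show "generalized_helix I \<alpha>"
      unfolding generalized_helix_def using \<open>unit_speed_curve I \<alpha>\<close> by blast
  }
qed

end
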